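(* Let $q\ge 1$ be an integer, write $q=6m+r$ with integers $m\ge 0$ and $0\le r\le 5$, and let $K$ be the knot or link that is the closure of the $3$-braid $(\sigma_1\sigma_2^{-1})^q$. Then the unknotting number of $K$ satisfies \[u(K)\le \begin{cases} 4m & \text{if } r=0,1,\\ 4m+1 & \text{if } r=2,\\ 4m+2 & \text{if } r=3,4,5.\end{cases}\] This upper bound is sharp in the sense that equality holds for $q=2$, $q=4$ and $q=5$ (where $K$ is $4_1$, $8_{18}$ and $10_{123}$, with unknotting numbers $1$, $2$ and $2$ respectively).
   Context: $\sigma_1,\sigma_2$ are the standard Artin generators of the braid group $B_3$. The unknotting number $u(K)$ of a knot or link $K$ in $S^3$ is the minimal number of crossing changes needed to turn $K$ into a trivial link (with the same number of components). Knot names $4_1$, $8_{18}$, $10_{123}$ are those of the standard (Rolfsen) table. *)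

theory Defs
  imports Main "HOL-Library.Multiset"
begin

section \<open>Link diagrams\<close>

text \<open>
  Links in the 3-sphere are represented by diagrams modulo Reidemeister moves. A planar diagram in
  general position with respect to a height function is cut into horizontal slices, each containing
  exactly one local minimum, local maximum or crossing. A slice \<open>(g, i)\<close> carries the piece \<open>g\<close> with
  exactly \<open>i\<close> vertical strands to its left; words are read upwards.

  \<open>Cup\<close> is a local minimum and \<open>Cap\<close> a local maximum. At a crossing the strand running from bottom
  left to top right is the upper one for \<open>Over\<close> and the lower one for \<open>Under\<close>. Orientations play no
  role for unknotting numbers, so diagrams are unoriented.
\<close>

datatype piece = Cup | Cap | Over | Under

type_synonym diagram = "(piece \<times> nat) list"

fun ends_below :: "piece \<Rightarrow> nat" where
  "ends_below Cup = 0"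
| "ends_below _ = 2"

fun ends_above :: "piece \<Rightarrow> nat" where
  "ends_above Cap = 0"
| "ends_above _ = 2"

text \<open>\<open>tangle n w m\<close>: the word \<open>w\<close> is a tangle diagram with \<open>n\<close> ends below and \<open>m\<close> ends above.\<close>

fun tangle :: "nat \<Rightarrow> diagram \<Rightarrow> nat \<Rightarrow> bool" where
  "tangle n [] m \<longleftrightarrow> n = m"
| "tangle n ((g, i) # w) m \<longleftrightarrow>
     i + ends_below g \<le> n \<and> tangle (n - ends_below g + ends_above g) w m"

definition link_diagram :: "diagram \<Rightarrow> bool" where
  "link_diagram D \<longleftrightarrow> tangle 0 D 0"

section \<open>Isotopy\<close>

text \<open>
  The moves up to \<open>slide_cap'\<close> generate planar isotopy of sliced diagrams (exchange of the heights
  of two distant pieces, cancellation of a maximum against a minimum, rotation of a crossing past an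
  extremum); the others are the three Reidemeister moves. By the theorem of Reidemeister in its
  sliced form (Freyd-Yetter, Turaev, Kauffman), two diagrams represent isotopic links iff they are
  related by these moves and their inverses. The remaining orientations of the Reidemeister moves
  follow from the listed ones.
\<close>

inductive move :: "diagram \<Rightarrow> diagram \<Rightarrow> bool" where
  exchange: "move [(g, i), (h, i + ends_above g + k)] [(h, i + ends_below g + k), (g, i)]"
| straighten_left: "move [(Cup, i), (Cap, i + 1)] []"
| straighten_right: "move [(Cup, i + 1), (Cap, i)] []"
| slide_cup: "move [(Cup, i), (Over, i + 1)] [(Cup, i + 1), (Under, i)]"
| slide_cup': "move [(Cup, i), (Under, i + 1)] [(Cup, i + 1), (Over, i)]"
| slide_cap: "move [(Over, i + 1), (Cap, i)] [(Under, i), (Cap, i + 1)]"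
| slide_cap': "move [(Under, i + 1), (Cap, i)] [(Over, i), (Cap, i + 1)]"
| R1_cup: "x \<in> {Over, Under} \<Longrightarrow> move [(Cup, i), (x, i)] [(Cup, i)]"
| R1_cap: "x \<in> {Over, Under} \<Longrightarrow> move [(x, i), (Cap, i)] [(Cap, i)]"
| R2: "move [(Over, i), (Under, i)] []"
| R2': "move [(Under, i), (Over, i)] []"
| R3: "x \<in> {Over, Under} \<Longrightarrow>
       move [(x, i), (x, i + 1), (x, i)] [(x, i + 1), (x, i), (x, i + 1)]"

definition isotopy_step :: "diagram \<Rightarrow> diagram \<Rightarrow> bool" where
  "isotopy_step D D' \<longleftrightarrow> link_diagram D \<and> link_diagram D' \<and>
     (\<exists>u v l r. (move l r \<or> move r l) \<and> D = u @ l @ v \<and> D' = u @ r @ v)"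

definition isotopic :: "diagram \<Rightarrow> diagram \<Rightarrow> bool" where
  "isotopic = isotopy_step\<^sup>*\<^sup>*"

section \<open>Unknotting number\<close>

text \<open>
  The components of a diagram are counted by following strands upwards: \<open>s\<close> lists the names of the
  strands met at the current height, \<open>n\<close> is a fresh name, \<open>c\<close> counts the components completed so
  far, and a maximum either completes a component or joins two strands.
\<close>

fun count_components :: "nat \<Rightarrow> nat list \<Rightarrow> nat \<Rightarrow> diagram \<Rightarrow> nat" where
  "count_components n s c [] = c"
| "count_components n s c ((Cup, i) # w) =
     count_components (n + 1) (take i s @ [n, n] @ drop i s) c w"
| "count_components n s c ((Cap, i) # w) =
     (let a = s ! i; b = s ! (i + 1)
      in count_components n (map (id(b := a)) (take i s @ drop (i + 2) s))
           (if a = b then c + 1 else c) w)"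
| "count_components n s c ((_, i) # w) =
     count_components n (s[i := s ! (i + 1), i + 1 := s ! i]) c w"

definition components :: "diagram \<Rightarrow> nat" where
  "components D = count_components 0 [] 0 D"

definition trivial_link :: "nat \<Rightarrow> diagram" where
  "trivial_link c = concat (replicate c [(Cup, 0), (Cap, 0)])"

definition crossing_change :: "diagram \<Rightarrow> diagram \<Rightarrow> bool" where
  "crossing_change D D' \<longleftrightarrow> link_diagram D \<and>
     (\<exists>u v i. D = u @ [(Over, i)] @ v \<and> D' = u @ [(Under, i)] @ v \<or>
              D = u @ [(Under, i)] @ v \<and> D' = u @ [(Over, i)] @ v)"

text \<open>
  \<open>crossing_changes n D D'\<close>: the link of \<open>D\<close> can be turned into that of \<open>D'\<close> by \<open>n\<close> crossing changes,
  each of which may be made in an arbitrary diagram of the link obtained so far.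
\<close>

inductive crossing_changes :: "nat \<Rightarrow> diagram \<Rightarrow> diagram \<Rightarrow> bool" where
  "isotopic D D' \<Longrightarrow> crossing_changes 0 D D'"
| "crossing_changes n D D1 \<Longrightarrow> crossing_change D1 D2 \<Longrightarrow> isotopic D2 D' \<Longrightarrow>
     crossing_changes (Suc n) D D'"

definition unknotting_number :: "diagram \<Rightarrow> nat" where
  "unknotting_number D = (LEAST n. crossing_changes n D (trivial_link (components D)))"

section \<open>Closed braids\<close>

text \<open>
  \<open>Sigma i\<close> and \<open>SigmaInv i\<close> are the Artin generator \<open>\<sigma>\<close> with index \<open>i\<close> (counted from 1) and its
  inverse. Which of the two is drawn as \<open>Over\<close> is a matter of convention; the other choice replaces
  every closed braid by its mirror image, which has the same unknotting number.
\<close>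

datatype braid_letter = Sigma nat | SigmaInv nat

fun braid_slice :: "braid_letter \<Rightarrow> piece \<times> nat" where
  "braid_slice (Sigma i) = (Over, i - 1)"
| "braid_slice (SigmaInv i) = (Under, i - 1)"

text \<open>
  The braid runs through the strands \<open>0, \<dots>, n - 1\<close>; nested cups and caps join the \<open>i\<close>-th of them to
  the returning strand \<open>2 * n - 1 - i\<close>.
\<close>

definition braid_closure :: "nat \<Rightarrow> braid_letter list \<Rightarrow> diagram" where
  "braid_closure n \<beta> =
     map (\<lambda>i. (Cup, i)) [0..<n] @ map braid_slice \<beta> @ map (\<lambda>i. (Cap, i)) (rev [0..<n])"

definition braid_power :: "braid_letter list \<Rightarrow> nat \<Rightarrow> braid_letter list" where
  "braid_power \<beta> q = concat (replicate q \<beta>)"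

section \<open>Knots of the Rolfsen table\<close>

text \<open>
  Knots of the table are given by planar diagram codes: the edges of a diagram are numbered and each
  crossing is listed as the four edges meeting there, counterclockwise, starting from an end of the
  lower strand. \<open>pd_scan\<close> extracts the crossings of a sliced diagram and the number of circles
  without crossings; its state is as for \<open>count_components\<close>, except that names change at crossings.
\<close>

type_synonym pd_code = "nat list list"

fun pd_scan :: "nat \<Rightarrow> nat list \<Rightarrow> pd_code \<Rightarrow> nat \<Rightarrow> diagram \<Rightarrow> pd_code \<times> nat" where
  "pd_scan n s X c [] = (X, c)"
| "pd_scan n s X c ((Cup, i) # w) =
     pd_scan (n + 1) (take i s @ [n, n] @ drop i s) X c w"
| "pd_scan n s X c ((Cap, i) # w) =
     (let a = s ! i; b = s ! (i + 1); f = id(b := a)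
      in pd_scan n (map f (take i s @ drop (i + 2) s)) (map (map f) X)
           (if a = b then c + 1 else c) w)"
| "pd_scan n s X c ((Over, i) # w) =
     pd_scan (n + 2) (s[i := n, i + 1 := n + 1]) (X @ [[s ! (i + 1), n + 1, n, s ! i]]) c w"
| "pd_scan n s X c ((Under, i) # w) =
     pd_scan (n + 2) (s[i := n, i + 1 := n + 1]) (X @ [[s ! i, s ! (i + 1), n + 1, n]]) c w"

text \<open>
  Codes are compared up to renaming of edges, order of the crossings, and the choice of the end of
  the lower strand at each crossing.
\<close>

definition same_pd_code :: "pd_code \<Rightarrow> pd_code \<Rightarrow> bool" where
  "same_pd_code X P \<longleftrightarrow> (\<exists>f. inj f \<and>
     image_mset (\<lambda>x. {map f x, rotate 2 (map f x)}) (mset X) =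
     image_mset (\<lambda>x. {x, rotate 2 x}) (mset P))"

definition has_pd_code :: "diagram \<Rightarrow> pd_code \<Rightarrow> bool" where
  "has_pd_code D P \<longleftrightarrow> (\<exists>X. pd_scan 0 [] [] 0 D = (X, 0) \<and> same_pd_code X P)"

text \<open>
  The link of \<open>D\<close> is the one with planar diagram code \<open>P\<close>. (A code determines a connected diagram on
  the sphere, hence a link type.)
\<close>

definition is_link_with_pd :: "diagram \<Rightarrow> pd_code \<Rightarrow> bool" where
  "is_link_with_pd D P \<longleftrightarrow> (\<exists>D'. link_diagram D' \<and> isotopic D D' \<and> has_pd_code D' P)"

text \<open>
  The edges are numbered consecutively along the knot, so that the codes correspond to the
  alternating diagrams with Dowker-Thistlethwaite codes \<open>4 6 8 2\<close>, \<open>6 8 10 12 14 16 2 4\<close> and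
  \<open>8 10 12 14 16 18 20 2 4 6\<close>. All three knots are amphicheiral, so no choice of mirror image is
  involved.
\<close>

definition rolfsen_4_1 :: pd_code where
  "rolfsen_4_1 = [[4, 2, 5, 1], [8, 6, 1, 5], [6, 3, 7, 4], [2, 7, 3, 8]]"

definition rolfsen_8_18 :: pd_code where
  "rolfsen_8_18 =
     [[6, 2, 7, 1], [8, 3, 9, 4], [16, 11, 1, 12], [2, 14, 3, 13],
      [4, 15, 5, 16], [10, 6, 11, 5], [12, 7, 13, 8], [14, 10, 15, 9]]"

definition rolfsen_10_123 :: pd_code where
  "rolfsen_10_123 =
     [[8, 2, 9, 1], [10, 3, 11, 4], [12, 6, 13, 5], [14, 7, 15, 8], [16, 10, 17, 9],
      [18, 11, 19, 12], [20, 14, 1, 13], [2, 15, 3, 16], [4, 18, 5, 17], [6, 19, 7, 20]]"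

end

theory Submission
  imports "HOL-Library.Numeral_Type" Defs
begin

text \<open>
  Write \<open>a\<close>, \<open>b\<close> for the Artin generators and \<open>A\<close>, \<open>B\<close> for their inverses. Two crossing changes
  remove a factor \<open>(aB)\<^sup>3\<close>: changing the first \<open>B\<close> of \<open>aBaBaB\<close> gives \<open>abaBaB = babBaB = baaB\<close>, and
  changing the second \<open>a\<close> of this gives \<open>baAB = 1\<close>. This reduces every exponent to 0, 1, 2 or 5. The
  power \<open>(aB)\<^sup>5\<close> needs only two changes, not three: changing its second \<open>a\<close> and fourth \<open>B\<close> gives
  \<open>aBABaBabaB = aBABaBba = aBABaa = aABAaa = Ba\<close>, which closes up to an unknot.

  Lower bounds come from Fox colourings by a finite commutative ring \<open>R\<close>: their number is an isotopy
  invariant, a crossing change alters it by a factor of at most \<open>|R|\<close>, and an unknot has \<open>|R|\<close> of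
  them. The three knots have \<open>5\<^sup>2\<close>, \<open>3\<^sup>3\<close> and \<open>11\<^sup>3\<close> colourings modulo 5, 3 and 11.
\<close>

section \<open>Isotopy of tangles and crossing changes\<close>

lemma tangle_append: "tangle n (u @ w) m \<longleftrightarrow> (\<exists>k. tangle n u k \<and> tangle k w m)"
  by (induction n u m rule: tangle.induct) auto

lemma tangle_appendI: "tangle n u k \<Longrightarrow> tangle k w m \<Longrightarrow> tangle n (u @ w) m"
  using tangle_append by blast

text \<open>\<open>isotopic\<close> speaks of closed diagrams only, so open tangles are compared
  through all their closures. Transitivity and stability under enlarging the tangle then come for
  free, without a separate notion of step for open diagrams.\<close>

definition tangle_isotopic :: "nat \<Rightarrow> nat \<Rightarrow> diagram \<Rightarrow> diagram \<Rightarrow> bool" where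
  "tangle_isotopic n m D D' \<longleftrightarrow> tangle n D m \<and> tangle n D' m \<and>
     (\<forall>u v. tangle 0 u n \<longrightarrow> tangle m v 0 \<longrightarrow> isotopic (u @ D @ v) (u @ D' @ v))"

lemma tangle_isotopic_move:
  assumes "move l r \<or> move r l" "D = u @ l @ v" "D' = u @ r @ v" "tangle n D m" "tangle n D' m"
  shows "tangle_isotopic n m D D'"
  unfolding tangle_isotopic_def
proof (intro conjI allI impI)
  fix x y assume xy: "tangle 0 x n" "tangle m y 0"
  have "link_diagram (x @ D @ y)" "link_diagram (x @ D' @ y)"
    unfolding link_diagram_def using xy assms(4,5) by (blast intro: tangle_appendI)+
  moreover have "\<exists>u v l r. (move l r \<or> move r l) \<and> x @ D @ y = u @ l @ v \<and> x @ D' @ y = u @ r @ v"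
    using assms(1-3) by (intro exI[of _ "x @ u"] exI[of _ "v @ y"] exI[of _ l] exI[of _ r]) simp
  ultimately show "isotopic (x @ D @ y) (x @ D' @ y)"
    unfolding isotopic_def isotopy_step_def by (intro r_into_rtranclp) blast
qed (use assms in auto)

text \<open>The gap \<open>k\<close> of the move becomes conditions on positions that simplification
  settles for concrete diagrams; the relation between \<open>j\<close> and \<open>j'\<close> is an
  equation of sums to avoid truncated subtraction.\<close>

lemma tangle_isotopic_exchange:
  assumes "D = u @ [(g, i), (h, j)] @ v" "D' = u @ [(h, j'), (g, i)] @ v"
    "i + ends_above g \<le> j" "j + ends_below g = j' + ends_above g"
    "tangle n D m" "tangle n D' m"
  shows "tangle_isotopic n m D D'" "tangle_isotopic n m D' D"
proof -
  obtain k where "j = i + ends_above g + k" using assms(3) le_Suc_ex by blast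
  moreover from this have "j' = i + ends_below g + k" using assms(4) by simp
  ultimately have "move [(g, i), (h, j)] [(h, j'), (g, i)]" using move.exchange by simp
  note move = tangle_isotopic_move[OF disjI1[OF this]] tangle_isotopic_move[OF disjI2[OF this]]
  show "tangle_isotopic n m D D'" by (rule move(1)[OF assms(1,2,5,6)])
  show "tangle_isotopic n m D' D" by (rule move(2)[OF assms(2,1,6,5)])
qed

lemma tangle_isotopic_trans [trans]:
  "tangle_isotopic n m D E \<Longrightarrow> tangle_isotopic n m E F \<Longrightarrow> tangle_isotopic n m D F"
  unfolding tangle_isotopic_def isotopic_def by (blast intro: rtranclp_trans)

lemma tangle_isotopic_context:
  assumes "tangle_isotopic n m D D'" "tangle k u n" "tangle m v j"
    "E = u @ D @ v" "E' = u @ D' @ v"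
  shows "tangle_isotopic k j E E'"
  unfolding tangle_isotopic_def
proof (intro conjI allI impI)
  fix x y assume xy: "tangle 0 x k" "tangle j y 0"
  have "tangle 0 (x @ u) n" "tangle m (v @ y) 0"
    using xy assms by (auto intro: tangle_appendI)
  hence "isotopic ((x @ u) @ D @ (v @ y)) ((x @ u) @ D' @ (v @ y))"
    using assms(1) unfolding tangle_isotopic_def by blast
  thus "isotopic (x @ E @ y) (x @ E' @ y)" by (simp add: assms)
qed (use assms in \<open>auto simp: tangle_isotopic_def intro!: tangle_appendI\<close>)

lemma tangle_isotopic_imp_isotopic: "tangle_isotopic 0 0 D D' \<Longrightarrow> isotopic D D'"
  unfolding tangle_isotopic_def by (auto dest!: spec[of _ "[]"])

section \<open>Sequences of crossing changes\<close>

lemma crossing_changes_isotopic: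
  assumes "crossing_changes k D E" "isotopic E F"
  shows "crossing_changes k D F"
  using assms(1)
proof cases
  case 1
  hence "isotopic D F" using assms(2) unfolding isotopic_def by (rule_tac rtranclp_trans)
  thus ?thesis using 1 by (simp add: crossing_changes.intros(1))
next
  case (2 n D1 D2)
  hence "isotopic D2 F" using assms(2) unfolding isotopic_def by (rule_tac rtranclp_trans)
  thus ?thesis using 2 by (simp add: crossing_changes.intros(2))
qed

text \<open>The later sequence is the first premise because \<open>crossing_changes\<close> grows at
  its far end: the induction runs over it while the earlier one stays fixed.\<close>

lemma crossing_changes_trans:
  "crossing_changes j E F \<Longrightarrow> crossing_changes k D E \<Longrightarrow> crossing_changes (k + j) D F"
proof (induction rule: crossing_changes.induct)
  case (1 E F)
  thus ?case by (simp add: crossing_changes_isotopic)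
next
  case (2 n D' D1 D2 F)
  thus ?case using crossing_changes.intros(2)[of "k + n" D D1 D2 F] by simp
qed

lemma crossing_changes_change:
  assumes "crossing_change D E" "tangle_isotopic 0 0 E F"
  shows "crossing_changes 1 D F"
proof -
  have "crossing_changes 0 D D" by (rule crossing_changes.intros) (simp add: isotopic_def)
  from crossing_changes.intros(2)[OF this assms(1) tangle_isotopic_imp_isotopic[OF assms(2)]]
  show ?thesis by simp
qed

lemma crossing_change_Over:
  "D = u @ (Over, i) # v \<Longrightarrow> E = u @ (Under, i) # v \<Longrightarrow> link_diagram D \<Longrightarrow> crossing_change D E"
  unfolding crossing_change_def by (intro conjI exI[of _ u] exI[of _ v] exI[of _ i]) simp_all

lemma crossing_change_Under:
  "D = u @ (Under, i) # v \<Longrightarrow> E = u @ (Over, i) # v \<Longrightarrow> link_diagram D \<Longrightarrow> crossing_change D E"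
  unfolding crossing_change_def by (intro conjI exI[of _ u] exI[of _ v] exI[of _ i]) simp_all

section \<open>Simplifying closed 3-braids\<close>

text \<open>Markov destabilisation in local form. Rotating the crossing past the maximum turns it
  into a kink on the minimum; the first Reidemeister move removes the kink, and the zigzag that
  remains is straightened.\<close>

lemma curl_removal:
  assumes "x \<in> {Over, Under}" "i < n"
  shows "tangle_isotopic n n [(Cup, i + 1), (x, i), (Cap, i + 1)] []"
proof -
  \<comment> \<open>Rotating a crossing past an extremum swaps \<open>Over\<close> and
    \<open>Under\<close>.\<close>
  define y where "y = (if x = Over then Under else Over)"
  have y: "y \<in> {Over, Under}" "move [(y, i + 1), (Cap, i)] [(x, i), (Cap, i + 1)]"
    using assms(1) move.slide_cap[of i] move.slide_cap'[of i] by (auto simp: y_def)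
  have [simp]: "ends_below x = 2" "ends_above x = 2" "ends_below y = 2" "ends_above y = 2"
    using assms(1) by (auto simp: y_def)
  have "tangle_isotopic n n [(Cup, i + 1), (x, i), (Cap, i + 1)] [(Cup, i + 1), (y, i + 1), (Cap, i)]"
    using assms y(2) by (intro tangle_isotopic_move[where u = "[(Cup, i + 1)]" and v = "[]"]) auto
  also have "tangle_isotopic n n \<dots> [(Cup, i + 1), (Cap, i)]"
    using assms move.R1_cup[OF y(1), of "i + 1"]
    by (intro tangle_isotopic_move[where u = "[]" and v = "[(Cap, i)]"]) auto
  also have "tangle_isotopic n n \<dots> []"
    using assms move.straighten_right[of i]
    by (intro tangle_isotopic_move[where u = "[]" and v = "[]"]) auto
  finally show ?thesis .
qed

abbreviation "nested_cups \<equiv> [(Cup, 0), (Cup, 1), (Cup, 2 :: nat)]"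
abbreviation "nested_caps \<equiv> [(Cap, 2), (Cap, 1), (Cap, 0 :: nat)]"

text \<open>Each generator occurs once, so two destabilisations remove both crossings, starting at
  the innermost closing strand. The order of the letters only decides whether \<open>x\<close>
  slides below the innermost minimum or above the innermost maximum.\<close>

lemma stabilized_unknot:
  assumes x: "x \<in> {Over, Under}" and y: "y \<in> {Over, Under}"
    and w: "w = [(x, 0), (y, 1)] \<or> w = [(y, 1), (x, 0)]"
  shows "tangle_isotopic 0 0 (nested_cups @ w @ nested_caps) (trivial_link 1)"
proof -
  have [simp]: "ends_below x = 2" "ends_above x = 2" "ends_below y = 2" "ends_above y = 2"
    using x y by auto
  let ?w = "[(Cup, 0), (Cup, 1), (x, 0)] @ [(Cup, 2), (y, 1), (Cap, 2)] @ [(Cap, 1), (Cap, 0)]"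
  let ?w' = "[(Cup, 0), (Cup, 1)] @ [(Cup, 2), (y, 1), (Cap, 2)] @ [(x, 0), (Cap, 1), (Cap, 0)]"
  have curl: "tangle_isotopic 4 4 [(Cup, 2), (y, 1), (Cap, 2)] []"
      "tangle_isotopic 2 2 [(Cup, 1), (x, 0), (Cap, 1)] []"
    using curl_removal[OF y, of 1 4] curl_removal[OF x, of 0 2] by (simp_all del: One_nat_def)
  have "tangle_isotopic 0 0 (nested_cups @ w @ nested_caps)
          [(Cup, 0), (Cup, 1), (x, 0), (Cap, 1), (Cap, 0)]"
    using w
  proof
    assume w: "w = [(x, 0), (y, 1)]"
    have "tangle_isotopic 0 0 (nested_cups @ w @ nested_caps) ?w"
      using w
      by (intro tangle_isotopic_exchange(2)[where u = "[(Cup, 0), (Cup, 1)]" and g = x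
            and h = Cup and i = 0 and j = 2
            and v = "(y, 1) # nested_caps"]) simp_all
    also have "tangle_isotopic 0 0 \<dots> [(Cup, 0), (Cup, 1), (x, 0), (Cap, 1), (Cap, 0)]"
      by (rule tangle_isotopic_context[OF curl(1), where u = "[(Cup, 0), (Cup, 1), (x, 0)]"
            and v = "[(Cap, 1), (Cap, 0)]"]) simp_all
    finally show ?thesis .
  next
    assume w: "w = [(y, 1), (x, 0)]"
    have "tangle_isotopic 0 0 (nested_cups @ w @ nested_caps) ?w'"
      using w
      by (intro tangle_isotopic_exchange(1)[where u = "nested_cups @ [(y, 1)]" and g = x
            and h = Cap and i = 0 and j = 2
            and v = "[(Cap, 1), (Cap, 0)]"]) simp_all
    also have "tangle_isotopic 0 0 \<dots> [(Cup, 0), (Cup, 1), (x, 0), (Cap, 1), (Cap, 0)]"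
      by (rule tangle_isotopic_context[OF curl(1), where u = "[(Cup, 0), (Cup, 1)]"
            and v = "[(x, 0), (Cap, 1), (Cap, 0)]"]) simp_all
    finally show ?thesis .
  qed
  also have "tangle_isotopic 0 0 \<dots> (trivial_link 1)"
    by (rule tangle_isotopic_context[OF curl(2), where u = "[(Cup, 0)]" and v = "[(Cap, 0)]"])
       (simp_all add: trivial_link_def)
  finally show ?thesis .
qed

text \<open>A second Reidemeister move overlaps the strand with the near side of the circle,
  rotations past the minimum and the maximum carry the two crossings to the far side, and there they
  cancel.\<close>

lemma circle_past_strand:
  assumes "i < n"
  shows "tangle_isotopic n n [(Cup, i + 1), (Cap, i + 1)] [(Cup, i), (Cap, i)]"
proof -
  have "tangle_isotopic n n [(Cup, i + 1), (Cap, i + 1)]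
          [(Cup, i + 1), (Under, i), (Over, i), (Cap, i + 1)]"
    using assms move.R2'[of i]
    by (intro tangle_isotopic_move[where u = "[(Cup, i + 1)]" and v = "[(Cap, i + 1)]"]) auto
  also have "tangle_isotopic n n \<dots> [(Cup, i), (Over, i + 1), (Over, i), (Cap, i + 1)]"
    using assms move.slide_cup[of i]
    by (intro tangle_isotopic_move[where u = "[]" and v = "[(Over, i), (Cap, i + 1)]"]) auto
  also have "tangle_isotopic n n \<dots> [(Cup, i), (Over, i + 1), (Under, i + 1), (Cap, i)]"
    using assms move.slide_cap'[of i]
    by (intro tangle_isotopic_move[where u = "[(Cup, i), (Over, i + 1)]" and v = "[]"]) auto
  also have "tangle_isotopic n n \<dots> [(Cup, i), (Cap, i)]"
    using assms move.R2[of "i + 1"]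
    by (intro tangle_isotopic_move[where u = "[(Cup, i)]" and v = "[(Cap, i)]"]) auto
  finally show ?thesis .
qed

text \<open>The circles stand side by side and overlap in height only, so exchanges of heights
  suffice.\<close>

lemma nested_circle_unnest:
  "tangle_isotopic 0 0 [(Cup, 0), (Cup, 0), (Cap, 0), (Cap, 0)] [(Cup, 0), (Cap, 0), (Cup, 0), (Cap, 0)]"
proof -
  have "tangle_isotopic 0 0 [(Cup, 0), (Cup, 0), (Cap, 0), (Cap, 0)]
          [(Cup, 0), (Cup, 2), (Cap, 0), (Cap, 0)]"
    by (rule tangle_isotopic_exchange(2)[where g = Cup and h = Cup and i = 0 and j = 2
          and u = "[]" and v = "[(Cap, 0), (Cap, 0)]"]) simp_all
  also have "tangle_isotopic 0 0 \<dots> [(Cup, 0), (Cap, 0), (Cup, 0), (Cap, 0)]"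
    by (rule tangle_isotopic_exchange(2)[where g = Cap and h = Cup and i = 0 and j = 0
          and u = "[(Cup, 0)]" and v = "[(Cap, 0)]"]) simp_all
  finally show ?thesis .
qed

text \<open>The three circles are concentric. The inner two are pulled out to the left, across the
  left strands of the circles around them; then the heights are separated.\<close>

lemma nested_circles_trivial:
  "tangle_isotopic 0 0 (nested_cups @ nested_caps) (trivial_link 3)"
proof -
  have outwards: "tangle_isotopic 4 4 [(Cup, 2), (Cap, 2)] [(Cup, 1), (Cap, 1)]"
      "tangle_isotopic 2 2 [(Cup, 1), (Cap, 1)] [(Cup, 0), (Cap, 0)]"
    using circle_past_strand[of 1 4] circle_past_strand[of 0 2] by (simp_all del: One_nat_def)
  have "tangle_isotopic 0 0 (nested_cups @ nested_caps)
          [(Cup, 0), (Cup, 1), (Cup, 1), (Cap, 1), (Cap, 1), (Cap, 0)]"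
    by (rule tangle_isotopic_context[OF outwards(1), where u = "[(Cup, 0), (Cup, 1)]"
          and v = "[(Cap, 1), (Cap, 0)]"]) simp_all
  also have "tangle_isotopic 0 0 \<dots> [(Cup, 0), (Cup, 1), (Cup, 3), (Cap, 1), (Cap, 1), (Cap, 0)]"
    by (rule tangle_isotopic_exchange(2)[where g = Cup and h = Cup and i = 1 and j = 3
          and u = "[(Cup, 0)]" and v = "[(Cap, 1), (Cap, 1), (Cap, 0)]"]) simp_all
  also have "tangle_isotopic 0 0 \<dots> [(Cup, 0), (Cup, 1), (Cap, 1), (Cup, 1), (Cap, 1), (Cap, 0)]"
    by (rule tangle_isotopic_exchange(2)[where g = Cap and h = Cup and i = 1 and j = 1
          and u = "[(Cup, 0), (Cup, 1)]" and v = "[(Cap, 1), (Cap, 0)]"]) simp_all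
  also have "tangle_isotopic 0 0 \<dots> [(Cup, 0), (Cup, 0), (Cap, 0), (Cup, 1), (Cap, 1), (Cap, 0)]"
    by (rule tangle_isotopic_context[OF outwards(2), where u = "[(Cup, 0)]"
          and v = "[(Cup, 1), (Cap, 1), (Cap, 0)]"]) simp_all
  also have "tangle_isotopic 0 0 \<dots> [(Cup, 0), (Cup, 0), (Cap, 0), (Cup, 0), (Cap, 0), (Cap, 0)]"
    by (rule tangle_isotopic_context[OF outwards(2), where u = "[(Cup, 0), (Cup, 0), (Cap, 0)]"
          and v = "[(Cap, 0)]"]) simp_all
  also have "tangle_isotopic 0 0 \<dots> [(Cup, 0), (Cup, 2), (Cap, 0), (Cup, 0), (Cap, 0), (Cap, 0)]"
    by (rule tangle_isotopic_exchange(2)[where g = Cup and h = Cup and i = 0 and j = 2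
          and u = "[]" and v = "[(Cap, 0), (Cup, 0), (Cap, 0), (Cap, 0)]"]) simp_all
  also have "tangle_isotopic 0 0 \<dots> [(Cup, 0), (Cap, 0), (Cup, 0), (Cup, 0), (Cap, 0), (Cap, 0)]"
    by (rule tangle_isotopic_exchange(2)[where g = Cap and h = Cup and i = 0 and j = 0
          and u = "[(Cup, 0)]" and v = "[(Cup, 0), (Cap, 0), (Cap, 0)]"]) simp_all
  also have "tangle_isotopic 0 0 \<dots> (trivial_link 3)"
    by (rule tangle_isotopic_context[OF nested_circle_unnest, where u = "[(Cup, 0), (Cap, 0)]"
          and v = "[]"]) (simp_all add: trivial_link_def numeral_3_eq_3)
  finally show ?thesis .
qed

section \<open>Upper bounds\<close>

lemma braid_cancel:
  assumes "i + 2 \<le> n"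
  shows "tangle_isotopic n n [(Over, i), (Under, i)] []" "tangle_isotopic n n [(Under, i), (Over, i)] []"
proof -
  show "tangle_isotopic n n [(Over, i), (Under, i)] []"
    using assms move.R2[of i] by (intro tangle_isotopic_move[where u = "[]" and v = "[]"]) auto
  show "tangle_isotopic n n [(Under, i), (Over, i)] []"
    using assms move.R2'[of i] by (intro tangle_isotopic_move[where u = "[]" and v = "[]"]) auto
qed

lemma braid_triple:
  assumes "n \<ge> 3" "x \<in> {Over, Under}"
  shows "tangle_isotopic n n [(x, 0), (x, 1), (x, 0)] [(x, 1), (x, 0), (x, 1)]"
  using assms move.R3[OF assms(2), of 0]
  by (intro tangle_isotopic_move[where u = "[]" and v = "[]"]) auto

text \<open>This is \<open>abaB = babB = ba\<close>, the simplification available once a crossing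
  change has turned a \<open>B\<close> into \<open>b\<close>.\<close>

lemma braid_triple_cancel:
  assumes "n \<ge> 3"
  shows "tangle_isotopic n n [(Over, 0), (Over, 1), (Over, 0), (Under, 1)] [(Over, 1), (Over, 0)]"
proof -
  have "tangle_isotopic n n [(Over, 0), (Over, 1), (Over, 0), (Under, 1)]
          [(Over, 1), (Over, 0), (Over, 1), (Under, 1)]"
    using assms
    by (intro tangle_isotopic_context[OF braid_triple[of n Over], where u = "[]" and v = "[(Under, 1)]"]) simp_all
  also have "tangle_isotopic n n \<dots> [(Over, 1), (Over, 0)]"
    using assms
    by (intro tangle_isotopic_context[OF braid_cancel(1)[of 1 n],
          where u = "[(Over, 1), (Over, 0)]" and v = "[]"]) simp_all
  finally show ?thesis .
qed

lemma two_changes_cube: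
  assumes u: "tangle 0 u n" and v: "tangle n v 0" and n: "n \<ge> 3"
  shows "crossing_changes 2
    (u @ [(Over, 0), (Under, 1), (Over, 0), (Under, 1), (Over, 0), (Under, 1)] @ v) (u @ v)"
proof -
  let ?D = "u @ [(Over, 0), (Under, 1), (Over, 0), (Under, 1), (Over, 0), (Under, 1)] @ v"
  let ?D1 = "u @ [(Over, 0), (Over, 1), (Over, 0), (Under, 1), (Over, 0), (Under, 1)] @ v"
  let ?D2 = "u @ [(Over, 1), (Over, 0), (Over, 0), (Under, 1)] @ v"
  let ?D3 = "u @ [(Over, 1), (Over, 0), (Under, 0), (Under, 1)] @ v"
  have link: "link_diagram (u @ w @ v)" if "tangle n w n" for w
    unfolding link_diagram_def using that u v by (blast intro: tangle_appendI)
  \<comment> \<open>\<open>tangle\<close> computes widths by truncated subtraction; as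
    \<open>n\<close> is at least 3, they return to \<open>n\<close> after each crossing.\<close>
  have n': "Suc (Suc (n - 2)) = n" "n - 2 \<ge> Suc 0" using n by simp_all
  have link1: "link_diagram ?D" by (rule link) (use n in auto)
  have link2: "link_diagram ?D2" by (rule link) (use n in auto)
  have first: "crossing_changes 1 ?D ?D2"
  proof (rule crossing_changes_change)
    show "crossing_change ?D ?D1"
      using link1 by (intro crossing_change_Under[where u = "u @ [(Over, 0)]"]) simp_all
    show "tangle_isotopic 0 0 ?D1 ?D2"
      using u v n
      by (intro tangle_isotopic_context[OF braid_triple_cancel[of n], where u = u
            and v = "[(Over, 0), (Under, 1)] @ v"]) (simp_all add: n')
  qed
  have second: "crossing_changes 1 ?D2 (u @ v)"
  proof (rule crossing_changes_change)
    show "crossing_change ?D2 ?D3"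
      using link2 by (intro crossing_change_Over[where u = "u @ [(Over, 1), (Over, 0)]"]) simp_all
    have "tangle_isotopic 0 0 ?D3 (u @ [(Over, 1), (Under, 1)] @ v)"
      using u v n
      by (intro tangle_isotopic_context[OF braid_cancel(1)[of 0 n], where u = "u @ [(Over, 1)]"
            and v = "[(Under, 1)] @ v"]) (auto simp: n' intro: tangle_appendI)
    also have "tangle_isotopic 0 0 \<dots> (u @ v)"
      using u v n
      by (intro tangle_isotopic_context[OF braid_cancel(1)[of 1 n], where u = u and v = v]) simp_all
    finally show "tangle_isotopic 0 0 ?D3 (u @ v)" .
  qed
  show ?thesis using crossing_changes_trans[OF second first] by (simp only: one_add_one)
qed

text \<open>The three-strand Turk's head links, with the braid already written in slices so that
  crossings can be rewritten in place.\<close>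

definition turks_head :: "nat \<Rightarrow> diagram" where
  "turks_head q = nested_cups @ concat (replicate q [(Over, 0), (Under, 1)]) @ nested_caps"

lemma braid_closure_turks_head: "braid_closure 3 (braid_power [Sigma 1, SigmaInv 2] q) = turks_head q"
proof -
  have "map braid_slice (braid_power [Sigma 1, SigmaInv 2] q) =
      concat (replicate q [(Over, 0), (Under, 1)])"
    unfolding braid_power_def by (induction q) auto
  thus ?thesis by (simp add: braid_closure_def turks_head_def upt_rec numeral_2_eq_2)
qed

lemma turks_head_reduce: "crossing_changes 2 (turks_head (q + 3)) (turks_head q)"
proof -
  have "tangle 6 (concat (replicate q [(Over, 0), (Under, 1)])) 6" by (induction q) auto
  hence "tangle 6 (concat (replicate q [(Over, 0), (Under, 1)]) @ nested_caps) 0"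
    by (rule tangle_appendI) simp
  from two_changes_cube[OF _ this, of nested_cups] show ?thesis
    by (simp add: turks_head_def numeral_3_eq_3)
qed

lemma turks_head_reduce_multiple: "crossing_changes (2 * k) (turks_head (3 * k + s)) (turks_head s)"
proof (induction k)
  case 0
  show ?case by (auto simp: isotopic_def intro: crossing_changes.intros)
next
  case (Suc k)
  from crossing_changes_trans[OF Suc turks_head_reduce[of "3 * k + s"]] show ?case
    by (simp add: algebra_simps)
qed

lemma turks_head_0: "crossing_changes 0 (turks_head 0) (trivial_link 3)"
  using tangle_isotopic_imp_isotopic[OF nested_circles_trivial]
  by (auto simp: turks_head_def intro: crossing_changes.intros)

lemma turks_head_1: "crossing_changes 0 (turks_head 1) (trivial_link 1)"
  using tangle_isotopic_imp_isotopic[OF stabilized_unknot[of Over Under "[(Over, 0), (Under, 1)]"]]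
  by (auto simp: turks_head_def intro: crossing_changes.intros)

lemma turks_head_2: "crossing_changes 1 (turks_head 2) (trivial_link 1)"
proof (rule crossing_changes_change)
  let ?D = "nested_cups @ [(Over, 0), (Over, 1), (Over, 0), (Under, 1)] @ nested_caps"
  show "crossing_change (turks_head 2) ?D"
    by (rule crossing_change_Under[where u = "nested_cups @ [(Over, 0)]"])
       (auto simp: turks_head_def numeral_2_eq_2 link_diagram_def)
  have "tangle_isotopic 0 0 ?D (nested_cups @ [(Over, 1), (Over, 0)] @ nested_caps)"
    by (rule tangle_isotopic_context[OF braid_triple_cancel[of 6], where u = nested_cups
          and v = nested_caps]) simp_all
  also have "tangle_isotopic 0 0 \<dots> (trivial_link 1)"
    by (rule stabilized_unknot) auto
  finally show "tangle_isotopic 0 0 ?D (trivial_link 1)" .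
qed

lemma turks_head_5: "crossing_changes 2 (turks_head 5) (trivial_link 1)"
proof -
  let ?D = "nested_cups @ [(Over, 0), (Under, 1), (Under, 0), (Under, 1), (Over, 0),
    (Under, 1), (Over, 0), (Under, 1), (Over, 0), (Under, 1)] @ nested_caps"
  let ?E = "nested_cups @ [(Over, 0), (Under, 1), (Under, 0), (Under, 1), (Over, 0),
    (Under, 1), (Over, 0), (Over, 1), (Over, 0), (Under, 1)] @ nested_caps"
  have "crossing_change (turks_head 5) ?D"
    by (rule crossing_change_Over[where u = "nested_cups @ [(Over, 0), (Under, 1)]"])
       (auto simp: turks_head_def eval_nat_numeral link_diagram_def)
  moreover have "tangle_isotopic 0 0 ?D ?D"
    by (simp add: tangle_isotopic_def isotopic_def)
  ultimately have first: "crossing_changes 1 (turks_head 5) ?D"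
    by (rule crossing_changes_change)
  have second: "crossing_changes 1 ?D (trivial_link 1)"
  proof (rule crossing_changes_change)
    show "crossing_change ?D ?E"
      by (rule crossing_change_Under[where u = "nested_cups @ [(Over, 0), (Under, 1), (Under, 0),
            (Under, 1), (Over, 0), (Under, 1), (Over, 0)]"]) (auto simp: link_diagram_def)
    have "tangle_isotopic 0 0 ?E (nested_cups @ [(Over, 0), (Under, 1), (Under, 0), (Under, 1),
        (Over, 0), (Under, 1), (Over, 1), (Over, 0)] @ nested_caps)"
      by (rule tangle_isotopic_context[OF braid_triple_cancel[of 6], where v = nested_caps
          and u = "nested_cups @ [(Over, 0), (Under, 1), (Under, 0), (Under, 1), (Over, 0), (Under, 1)]"]) simp_all
    also have "tangle_isotopic 0 0 \<dots> (nested_cups @ [(Over, 0), (Under, 1), (Under, 0), (Under, 1),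
        (Over, 0), (Over, 0)] @ nested_caps)"
      by (rule tangle_isotopic_context[OF braid_cancel(2)[of 1 6], where v = "(Over, 0) # nested_caps"
          and u = "nested_cups @ [(Over, 0), (Under, 1), (Under, 0), (Under, 1), (Over, 0)]"]) simp_all
    \<comment> \<open>The braid relation \<open>BAB = ABA\<close> for inverse letters, which is
      \<open>R3\<close> read backwards; it brings an \<open>A\<close> next to the leading
      \<open>a\<close>.\<close>
    also have "tangle_isotopic 0 0 \<dots> (nested_cups @ [(Over, 0), (Under, 0), (Under, 1), (Under, 0),
        (Over, 0), (Over, 0)] @ nested_caps)"
      using move.R3[of Under 0]
      by (intro tangle_isotopic_move[where v = "(Over, 0) # (Over, 0) # nested_caps"
          and u = "nested_cups @ [(Over, 0)]"]) auto
    also have "tangle_isotopic 0 0 \<dots> (nested_cups @ [(Under, 1), (Under, 0), (Over, 0), (Over, 0)]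
        @ nested_caps)"
      by (rule tangle_isotopic_context[OF braid_cancel(1)[of 0 6],
          where v = "[(Under, 1), (Under, 0), (Over, 0), (Over, 0)] @ nested_caps" and u = nested_cups]) simp_all
    also have "tangle_isotopic 0 0 \<dots> (nested_cups @ [(Under, 1), (Over, 0)] @ nested_caps)"
      by (rule tangle_isotopic_context[OF braid_cancel(2)[of 0 6],
          where v = "(Over, 0) # nested_caps" and u = "nested_cups @ [(Under, 1)]"]) simp_all
    also have "tangle_isotopic 0 0 \<dots> (trivial_link 1)"
      by (rule stabilized_unknot) auto
    finally show "tangle_isotopic 0 0 ?E (trivial_link 1)" .
  qed
  show ?thesis using crossing_changes_trans[OF second first] by (simp only: one_add_one)
qed

text \<open>The braid \<open>aB\<close> permutes its three strands cyclically, so three factors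
  restore their names. Crossings change neither the fresh name nor the count, and the returning
  strands \<open>t\<close> are not met.\<close>

lemma count_components_turks_head:
  "count_components n (x # y # z # t) c (concat (replicate (3 * k + s) [(Over, 0), (Under, 1)]) @ v)
   = count_components n (x # y # z # t) c (concat (replicate s [(Over, 0), (Under, 1)]) @ v)"
  by (induction k) (auto simp: numeral_3_eq_3)

lemma components_turks_head:
  assumes "s < 3"
  shows "components (turks_head (3 * k + s)) = (if s = 0 then 3 else 1)"
proof -
  have "components (turks_head q) =
      count_components 3 [0, 1, 2, 2, 1, 0] 0 (concat (replicate q [(Over, 0), (Under, 1)]) @ nested_caps)" for q
    by (simp add: components_def turks_head_def numeral_2_eq_2 numeral_3_eq_3)
  hence eq: "components (turks_head (3 * k + s)) =
      count_components 3 [0, 1, 2, 2, 1, 0] 0 (concat (replicate s [(Over, 0), (Under, 1)]) @ nested_caps)"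
    by (simp only: count_components_turks_head)
  from assms consider "s = 0" | "s = 1" | "s = 2" by linarith
  thus ?thesis unfolding eq by cases (simp_all add: numeral_2_eq_2)
qed

lemma unknotting_number_turks_head_le:
  assumes "crossing_changes n (turks_head s) (trivial_link (if s mod 3 = 0 then 3 else 1))"
  shows "unknotting_number (turks_head (3 * k + s)) \<le> 2 * k + n"
proof -
  \<comment> \<open>\<open>s\<close> may exceed 2 (it is 5 for the last residue), so its own
    remainder is split off before the components are counted.\<close>
  have split: "3 * k + s = 3 * (k + s div 3) + s mod 3" by simp
  have "components (turks_head (3 * k + s)) = (if s mod 3 = 0 then 3 else 1)"
    unfolding split by (rule components_turks_head) simp
  hence "crossing_changes (2 * k + n) (turks_head (3 * k + s)) (trivial_link (components (turks_head (3 * k + s))))"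
    using crossing_changes_trans[OF assms turks_head_reduce_multiple] by (simp only:)
  thus ?thesis unfolding unknotting_number_def by (rule Least_le)
qed

text \<open>In \<open>q = 3 * k + s\<close> the residues 0, 1, 2 and 5 are themselves
  \<open>s\<close>, with \<open>k = 2 * m\<close>; the residues 3 and 4 give up one more cube and
  leave \<open>s = 0\<close> and \<open>s = 1\<close>.\<close>

lemma unknotting_number_turks_head_bound:
  assumes "q = 6 * m + r" "r \<le> 5"
  shows "unknotting_number (turks_head q) \<le>
    (if r = 0 \<or> r = 1 then 4 * m else if r = 2 then 4 * m + 1 else 4 * m + 2)"
proof -
  note bounds = unknotting_number_turks_head_le[of 0 0] unknotting_number_turks_head_le[of 0 1]
    unknotting_number_turks_head_le[of 1 2] unknotting_number_turks_head_le[of 2 5]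
  have "r \<in> {0, 1, 2, 3, 4, 5}" using assms(2) by auto
  thus ?thesis
  proof (elim insertE emptyE)
    assume r: "r = 0"
    with assms have q: "q = 3 * (2 * m) + 0" by simp
    show ?thesis unfolding q using bounds(1)[of "2 * m"] turks_head_0 by (simp add: r)
  next
    assume r: "r = 1"
    with assms have q: "q = 3 * (2 * m) + 1" by simp
    show ?thesis unfolding q using bounds(2)[of "2 * m"] turks_head_1 by (simp add: r)
  next
    assume r: "r = 2"
    with assms have q: "q = 3 * (2 * m) + 2" by simp
    show ?thesis unfolding q using bounds(3)[of "2 * m"] turks_head_2 by (simp add: r)
  next
    assume r: "r = 3"
    with assms have q: "q = 3 * (2 * m + 1) + 0" by simp
    show ?thesis unfolding q using bounds(1)[of "2 * m + 1"] turks_head_0 by (simp add: r)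
  next
    assume r: "r = 4"
    with assms have q: "q = 3 * (2 * m + 1) + 1" by simp
    show ?thesis unfolding q using bounds(2)[of "2 * m + 1"] turks_head_1 by (simp add: r)
  next
    assume r: "r = 5"
    with assms have q: "q = 3 * (2 * m) + 5" by simp
    show ?thesis unfolding q using bounds(4)[of "2 * m"] turks_head_5 by (simp add: r)
  qed
qed

section \<open>Colourings\<close>

definition insert_pair :: "nat \<Rightarrow> 'a \<Rightarrow> (nat \<Rightarrow> 'a) \<Rightarrow> nat \<Rightarrow> 'a" where
  "insert_pair i x s = (\<lambda>j. if j < i then s j else if j < i + 2 then x else s (j - 2))"

definition delete_pair :: "nat \<Rightarrow> (nat \<Rightarrow> 'a) \<Rightarrow> nat \<Rightarrow> 'a" where
  "delete_pair i s = (\<lambda>j. if j < i then s j else s (j + 2))"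

text \<open>In a colouring by a ring the colour of the upper strand is the mean of the two lower ones.\<close>

definition pass_over :: "nat \<Rightarrow> (nat \<Rightarrow> 'a :: comm_ring_1) \<Rightarrow> nat \<Rightarrow> 'a" where
  "pass_over i s = s(i := 2 * s i - s (i + 1), i + 1 := s i)"

definition pass_under :: "nat \<Rightarrow> (nat \<Rightarrow> 'a :: comm_ring_1) \<Rightarrow> nat \<Rightarrow> 'a" where
  "pass_under i s = s(i := s (i + 1), i + 1 := 2 * s (i + 1) - s i)"

lemmas state_defs = insert_pair_def delete_pair_def pass_over_def pass_under_def

text \<open>A diagram acts as a transfer operator: \<open>f\<close> weighs the states at the top,
  and the value at \<open>s\<close> sums these weights over the colourings that start with
  \<open>s\<close> at the bottom. Weight 1 counts colourings; general weights allow cutting a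
  diagram at any height.\<close>

fun colorings :: "((nat \<Rightarrow> 'a :: {finite, comm_ring_1}) \<Rightarrow> nat) \<Rightarrow> (nat \<Rightarrow> 'a) \<Rightarrow> diagram \<Rightarrow> nat" where
  "colorings f s [] = f s"
| "colorings f s ((Cup, i) # w) = (\<Sum>x\<in>UNIV. colorings f (insert_pair i x s) w)"
| "colorings f s ((Cap, i) # w) = (if s i = s (i + 1) then colorings f (delete_pair i s) w else 0)"
| "colorings f s ((Over, i) # w) = colorings f (pass_over i s) w"
| "colorings f s ((Under, i) # w) = colorings f (pass_under i s) w"

lemma colorings_append: "colorings f s (u @ w) = colorings (\<lambda>t. colorings f t w) s u"
  by (induction f s u rule: colorings.induct) auto

text \<open>Distant pieces act on disjoint positions, so their state operations commute once the
  position of the right piece is shifted by the number of strands that the left one creates or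
  deletes.\<close>

lemma colorings_exchange:
  "colorings f s [(g, i), (h, i + ends_above g + k)] = colorings f s [(h, i + ends_below g + k), (g, i)]"
proof (cases g; cases h)
  assume gh: "g = Cup" "h = Cup"
  have "insert_pair (i + 2 + k) y (insert_pair i x s) = insert_pair i x (insert_pair (i + k) y s)" for x y
    by (rule ext) (auto simp: state_defs)
  thus ?thesis using gh by simp (rule sum.swap)
next
  assume gh: "g = Cup" "h = Cap"
  have "delete_pair (i + 2 + k) (insert_pair i x s) = insert_pair i x (delete_pair (i + k) s)" for x
    by (rule ext) (auto simp: state_defs intro!: arg_cong[of _ _ s])
  thus ?thesis using gh by (simp add: state_defs)
next
  assume gh: "g = Cup" "h = Over"
  have "pass_over (i + 2 + k) (insert_pair i x s) = insert_pair i x (pass_over (i + k) s)" for x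
    by (rule ext) (auto simp: state_defs)
  thus ?thesis using gh by simp
next
  assume gh: "g = Cup" "h = Under"
  have "pass_under (i + 2 + k) (insert_pair i x s) = insert_pair i x (pass_under (i + k) s)" for x
    by (rule ext) (auto simp: state_defs)
  thus ?thesis using gh by simp
next
  assume gh: "g = Cap" "h = Cup"
  have "insert_pair (i + k) y (delete_pair i s) = delete_pair i (insert_pair (i + 2 + k) y s)" for y
    by (rule ext) (auto simp: state_defs intro!: arg_cong[of _ _ s])
  thus ?thesis using gh by (simp add: state_defs)
next
  assume gh: "g = Cap" "h = Cap"
  have "delete_pair (i + k) (delete_pair i s) = delete_pair i (delete_pair (i + 2 + k) s)"
    by (rule ext) (auto simp: state_defs)
  thus ?thesis using gh by (simp add: state_defs)
next
  assume gh: "g = Cap" "h = Over"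
  have "pass_over (i + k) (delete_pair i s) = delete_pair i (pass_over (i + 2 + k) s)"
    by (rule ext) (auto simp: state_defs)
  thus ?thesis using gh by (simp add: state_defs)
next
  assume gh: "g = Cap" "h = Under"
  have "pass_under (i + k) (delete_pair i s) = delete_pair i (pass_under (i + 2 + k) s)"
    by (rule ext) (auto simp: state_defs)
  thus ?thesis using gh by (simp add: state_defs)
next
  assume gh: "g = Over" "h = Cup"
  have "insert_pair (i + 2 + k) y (pass_over i s) = pass_over i (insert_pair (i + 2 + k) y s)" for y
    by (rule ext) (auto simp: state_defs)
  thus ?thesis using gh by simp
next
  assume gh: "g = Over" "h = Cap"
  have "delete_pair (i + 2 + k) (pass_over i s) = pass_over i (delete_pair (i + 2 + k) s)"
    by (rule ext) (auto simp: state_defs)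
  thus ?thesis using gh by (simp add: state_defs)
next
  assume gh: "g = Over" "h = Over"
  have "pass_over (i + 2 + k) (pass_over i s) = pass_over i (pass_over (i + 2 + k) s)"
    by (rule ext) (auto simp: state_defs)
  thus ?thesis using gh by simp
next
  assume gh: "g = Over" "h = Under"
  have "pass_under (i + 2 + k) (pass_over i s) = pass_over i (pass_under (i + 2 + k) s)"
    by (rule ext) (auto simp: state_defs)
  thus ?thesis using gh by simp
next
  assume gh: "g = Under" "h = Cup"
  have "insert_pair (i + 2 + k) y (pass_under i s) = pass_under i (insert_pair (i + 2 + k) y s)" for y
    by (rule ext) (auto simp: state_defs)
  thus ?thesis using gh by simp
next
  assume gh: "g = Under" "h = Cap"
  have "delete_pair (i + 2 + k) (pass_under i s) = pass_under i (delete_pair (i + 2 + k) s)"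
    by (rule ext) (auto simp: state_defs)
  thus ?thesis using gh by (simp add: state_defs)
next
  assume gh: "g = Under" "h = Over"
  have "pass_over (i + 2 + k) (pass_under i s) = pass_under i (pass_over (i + 2 + k) s)"
    by (rule ext) (auto simp: state_defs)
  thus ?thesis using gh by simp
next
  assume gh: "g = Under" "h = Under"
  have "pass_under (i + 2 + k) (pass_under i s) = pass_under i (pass_under (i + 2 + k) s)"
    by (rule ext) (auto simp: state_defs)
  thus ?thesis using gh by simp
qed

text \<open>A maximum meeting a minimum forces the colour chosen there, leaving one term of the
  sum.\<close>

lemma sum_UNIV_delta:
  "(\<Sum>x\<in>UNIV. if a = (x :: 'a :: finite) then g x else (0 :: nat)) = g a"
  "(\<Sum>x\<in>UNIV. if x = a then g x else 0) = g a"
  by (simp_all add: sum.delta sum.delta')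

lemma colorings_move: "move l r \<Longrightarrow> colorings f s l = colorings f s r"
proof (induction rule: move.induct)
  case (exchange g i h k)
  show ?case by (rule colorings_exchange)
next
  case (straighten_left i)
  have "delete_pair (i + 1) (insert_pair i (s i) s) = s"
    by (auto simp: state_defs fun_eq_iff less_Suc_eq)
  moreover have "insert_pair i x s (i + 1) = x" "insert_pair i x s (i + 2) = s i" for x
    by (auto simp: insert_pair_def)
  ultimately show ?case by (simp add: sum_UNIV_delta)
next
  case (straighten_right i)
  have "delete_pair i (insert_pair (i + 1) (s i) s) = s"
    by (auto simp: state_defs fun_eq_iff less_Suc_eq)
  moreover have "insert_pair (i + 1) x s i = s i" "insert_pair (i + 1) x s (i + 1) = x" for x
    by (auto simp: insert_pair_def)
  ultimately show ?case by (simp add: sum_UNIV_delta)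
next
  case (slide_cup' i)
  \<comment> \<open>One end of the minimum passes under the strand coloured \<open>s i\<close>,
    which reflects its colour \<open>x\<close> to \<open>2 * s i - x\<close>. The sums over the
    colour of the minimum on the two sides are matched by this involution.\<close>
  have "pass_over i (insert_pair (i + 1) (2 * s i - x) s) = pass_under (i + 1) (insert_pair i x s)" for x
    by (rule ext) (auto simp: state_defs less_Suc_eq intro!: arg_cong[of _ _ s])
  thus ?case
    by simp (rule sum.reindex_bij_witness[of _ "\<lambda>x. 2 * s i - x" "\<lambda>x. 2 * s i - x"]; simp)
next
  case (R1_cup x i)
  thus ?case by (auto simp: state_defs fun_eq_iff intro!: sum.cong arg_cong[of _ _ f])
next
  case (R1_cap x i)
  thus ?case by (auto simp: state_defs fun_eq_iff algebra_simps intro!: arg_cong[of _ _ f])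
next
  case (R3 x i)
  thus ?case by (auto simp: state_defs fun_eq_iff algebra_simps intro!: arg_cong[of _ _ f])
qed (auto simp: state_defs fun_eq_iff algebra_simps intro!: sum.cong arg_cong[of _ _ f])

text \<open>
  All strands to the right of the diagram get the colour 0, so that the states need no lengths.
\<close>

definition num_colorings :: "'a :: {finite, comm_ring_1} itself \<Rightarrow> diagram \<Rightarrow> nat" where
  "num_colorings _ D = colorings (\<lambda>_. 1) (\<lambda>_. 0 :: 'a) D"

lemma num_colorings_isotopic:
  assumes "isotopic D D'"
  shows "num_colorings T D = num_colorings T D'"
  using assms unfolding isotopic_def
proof induction
  case (step D D')
  have "num_colorings T D = num_colorings T D'"
    using step(2) colorings_move[where 'a = 'a]
    unfolding isotopy_step_def num_colorings_def by (auto simp: colorings_append)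
  with step show ?case by simp
qed simp

text \<open>
  If such an \<open>f\<close> is not zero, it takes a constant value on its support, which is a coset of the subgroup
  supporting \<open>g\<close>.
\<close>

definition translate_of :: "((nat \<Rightarrow> 'a :: ab_group_add) \<Rightarrow> nat) \<Rightarrow> ((nat \<Rightarrow> 'a) \<Rightarrow> nat) \<Rightarrow> bool" where
  "translate_of f g \<longleftrightarrow> (\<forall>s t. f t \<noteq> 0 \<longrightarrow> f s = g (\<lambda>j. s j - t j))"

text \<open>The operations on states are additive and the test at a maximum is a linear condition,
  so each slice preserves the coset structure.\<close>

lemma translate_of_colorings:
  assumes "translate_of f g"
  shows "translate_of (\<lambda>s. colorings f s w) (\<lambda>s. colorings g s w)"
  using assms
proof (induction w arbitrary: f g)
  case Nil
  thus ?case by simp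
next
  case (Cons p w)
  obtain x i where p: "p = (x, i)" by fastforce
  note IH = Cons.IH[OF Cons.prems, unfolded translate_of_def, rule_format]
  show ?case
  proof (cases x)
    case Cup
    show ?thesis unfolding translate_of_def
    proof (intro allI impI)
      fix s t assume "colorings f t (p # w) \<noteq> 0"
      \<comment> \<open>\<open>y\<close> is the colour at the minimum in some colouring that extends
        \<open>t\<close>. Subtracting that colouring turns a choice \<open>z\<close> above
        \<open>s\<close> into \<open>z - y\<close>, and the shift by \<open>y\<close> reindexes the
        sum.\<close>
      then obtain y where y: "colorings f (insert_pair i y t) w \<noteq> 0"
        by (auto simp: p Cup sum.neutral)
      have "insert_pair i (z - y) (\<lambda>j. s j - t j) = (\<lambda>j. insert_pair i z s j - insert_pair i y t j)" for z
        by (auto simp: insert_pair_def)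
      hence "colorings f (insert_pair i z s) w = colorings g (insert_pair i (z - y) (\<lambda>j. s j - t j)) w" for z
        using IH[OF y, of "insert_pair i z s"] by simp
      hence "colorings f s (p # w) = (\<Sum>z\<in>UNIV. colorings g (insert_pair i (z - y) (\<lambda>j. s j - t j)) w)"
        by (simp add: p Cup)
      also have "\<dots> = (\<Sum>z\<in>UNIV. colorings g (insert_pair i z (\<lambda>j. s j - t j)) w)"
        by (rule sum.reindex_bij_witness[of _ "\<lambda>z. z + y" "\<lambda>z. z - y"]) auto
      finally show "colorings f s (p # w) = colorings g (\<lambda>j. s j - t j) (p # w)"
        by (simp add: p Cup)
    qed
  next
    case Cap
    show ?thesis unfolding translate_of_def
    proof (intro allI impI)
      fix s t assume t: "colorings f t (p # w) \<noteq> 0"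
      have "delete_pair i (\<lambda>j. s j - t j) = (\<lambda>j. delete_pair i s j - delete_pair i t j)"
        by (auto simp: delete_pair_def)
      thus "colorings f s (p # w) = colorings g (\<lambda>j. s j - t j) (p # w)"
        using IH[of "delete_pair i t" "delete_pair i s"] t by (auto simp: p Cap split: if_splits)
    qed
  next
    case Over
    show ?thesis unfolding translate_of_def
    proof (intro allI impI)
      fix s t assume t: "colorings f t (p # w) \<noteq> 0"
      have "pass_over i (\<lambda>j. s j - t j) = (\<lambda>j. pass_over i s j - pass_over i t j)"
        by (auto simp: state_defs fun_eq_iff algebra_simps)
      thus "colorings f s (p # w) = colorings g (\<lambda>j. s j - t j) (p # w)"
        using IH[of "pass_over i t" "pass_over i s"] t by (simp add: p Over)
    qed
  next
    case Under
    show ?thesis unfolding translate_of_def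
    proof (intro allI impI)
      fix s t assume t: "colorings f t (p # w) \<noteq> 0"
      have "pass_under i (\<lambda>j. s j - t j) = (\<lambda>j. pass_under i s j - pass_under i t j)"
        by (auto simp: state_defs fun_eq_iff algebra_simps)
      thus "colorings f s (p # w) = colorings g (\<lambda>j. s j - t j) (p # w)"
        using IH[of "pass_under i t" "pass_under i s"] t by (simp add: p Under)
    qed
  qed
qed

lemma colorings_sum: "colorings (\<lambda>s. \<Sum>d\<in>A. f d s) s w = (\<Sum>d\<in>A. colorings (f d) s w)"
  by (induction "\<lambda>s. \<Sum>d\<in>A. f d s" s w rule: colorings.induct)
     (simp_all add: sum.swap[of _ A UNIV])

lemma colorings_mono: "(\<And>s. f s \<le> g s) \<Longrightarrow> colorings f s w \<le> colorings g s w"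
  by (induction f s w rule: colorings.induct) (simp_all add: sum_mono)

text \<open>
  The colourings in which the two strands at the crossing have equal colours do not depend on its
  sign. Sorted by the difference of these colours, the colourings of the left-hand side fall into
  classes that are empty or translates of these.
\<close>

lemma num_colorings_crossing:
  fixes T :: "'a :: {finite, comm_ring_1} itself"
  assumes "x \<in> {Over, Under}" "y \<in> {Over, Under}"
  shows "num_colorings T (u @ (x, i) # v) \<le> CARD('a) * num_colorings T (u @ (y, i) # v)"
proof -
  let ?z = "\<lambda>_ :: nat. 0 :: 'a"
  define f where "f = (\<lambda>x s. colorings (\<lambda>_ :: nat \<Rightarrow> 'a. 1) s ((x, i) # v))"
  define g where "g d s = (if s i - s (i + 1) = d then f x s else 0)" for d s
  have f: "translate_of (f x) (f x)"
    unfolding f_def by (rule translate_of_colorings) (simp add: translate_of_def)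
  have "translate_of (g d) (g 0)" for d
    unfolding translate_of_def
  proof (intro allI impI)
    fix s t assume "g d t \<noteq> 0"
    hence t: "t i - t (i + 1) = d" "f x t \<noteq> 0" by (auto simp: g_def split: if_splits)
    have "f x s = f x (\<lambda>j. s j - t j)"
      using f t(2) unfolding translate_of_def by blast
    moreover have "s i - s (i + 1) = d \<longleftrightarrow> s i - t i - (s (i + 1) - t (i + 1)) = 0"
      unfolding t(1)[symmetric] by (simp add: diff_diff_eq2 diff_eq_eq algebra_simps)
    ultimately show "g d s = g 0 (\<lambda>j. s j - t j)"
      by (simp only: g_def)
  qed
  hence "translate_of (\<lambda>s. colorings (g d) s u) (\<lambda>s. colorings (g 0) s u)" for d
    by (rule translate_of_colorings)
  \<comment> \<open>No strand enters from below, so both states are the zero state and their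
    difference is again zero: a nonempty class is as large as the class of difference 0.\<close>
  hence "colorings (g d) ?z u \<noteq> 0 \<Longrightarrow> colorings (g d) ?z u = colorings (g 0) (\<lambda>j. ?z j - ?z j) u" for d
    unfolding translate_of_def by blast
  hence le: "colorings (g d) ?z u \<le> colorings (g 0) ?z u" for d
    by (cases "colorings (g d) ?z u = 0") simp_all
  have same: "pass_over i s = pass_under i s" if "s i = s (i + 1)" for s :: "nat \<Rightarrow> 'a"
    using that by (simp add: state_defs fun_eq_iff)
  have "f x = (\<lambda>s. \<Sum>d\<in>UNIV. g d s)"
    by (simp add: g_def fun_eq_iff sum.delta)
  hence "num_colorings T (u @ (x, i) # v) = (\<Sum>d\<in>UNIV. colorings (g d) ?z u)"
    by (simp add: num_colorings_def colorings_append f_def colorings_sum)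
  also have "\<dots> \<le> (\<Sum>d :: 'a \<in> UNIV. colorings (g 0) ?z u)"
    by (intro sum_mono le)
  also have "\<dots> = CARD('a) * colorings (g 0) ?z u" by simp
  also have "colorings (g 0) ?z u \<le> colorings (f y) ?z u"
  proof (rule colorings_mono)
    fix s :: "nat \<Rightarrow> 'a"
    show "g 0 s \<le> f y s"
      using assms same[of s] by (cases "s i = s (i + 1)") (auto simp: g_def f_def)
  qed
  also have "colorings (f y) ?z u = num_colorings T (u @ (y, i) # v)"
    by (simp add: num_colorings_def colorings_append f_def)
  finally show ?thesis by simp
qed

lemma num_colorings_crossing_changes:
  fixes T :: "'a :: {finite, comm_ring_1} itself"
  assumes "crossing_changes n D D'"
  shows "num_colorings T D \<le> CARD('a) ^ n * num_colorings T D'"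
  using assms
proof induction
  case (1 D D')
  thus ?case by (simp add: num_colorings_isotopic)
next
  case (2 n D D1 D2 D')
  have "num_colorings T D1 \<le> CARD('a) * num_colorings T D2"
    using 2(2) num_colorings_crossing[of _ _ T]
    unfolding crossing_change_def by auto
  hence "CARD('a) ^ n * num_colorings T D1 \<le> CARD('a) ^ n * (CARD('a) * num_colorings T D')"
    unfolding num_colorings_isotopic[OF 2(3)] by (rule mult_le_mono2)
  from order_trans[OF 2(4) this] show ?case by (simp add: mult_ac)
qed

lemma num_colorings_trivial_link_1:
  fixes T :: "'a :: {finite, comm_ring_1} itself"
  shows "num_colorings T (trivial_link 1) = CARD('a)"
  by (simp add: num_colorings_def trivial_link_def insert_pair_def)

text \<open>The summand 1 stands for the constant colourings, which the unknot has as well.\<close>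

lemma crossing_changes_lower_bound:
  fixes T :: "'a :: {finite, comm_ring_1} itself"
  assumes "crossing_changes n D (trivial_link 1)" "num_colorings T D = CARD('a) ^ k" "CARD('a) > 1"
  shows "k \<le> n + 1"
proof -
  have "CARD('a) ^ k \<le> CARD('a) ^ (n + 1)"
    using num_colorings_crossing_changes[OF assms(1), where T = T]
    by (simp only: assms(2) num_colorings_trivial_link_1 power_add power_one_right)
  thus ?thesis using assms(3) by (rule power_le_imp_le_exp[rotated])
qed

section \<open>Colourings of Turk's head links\<close>

definition six_strands :: "'a :: comm_ring_1 \<Rightarrow> 'a \<Rightarrow> 'a \<Rightarrow> 'a \<Rightarrow> 'a \<Rightarrow> 'a \<Rightarrow> nat \<Rightarrow> 'a" where
  "six_strands x y z u v w = (\<lambda>_. 0)(0 := x, 1 := y, 2 := z, 3 := u, 4 := v, 5 := w)"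

lemma colorings_nested_cups:
  "colorings f (\<lambda>_. 0) (nested_cups @ D) =
    (\<Sum>x\<in>UNIV. \<Sum>y\<in>UNIV. \<Sum>z\<in>UNIV. colorings f (six_strands x y z z y x) D)"
proof -
  have "insert_pair 2 z (insert_pair 1 y (insert_pair 0 x (\<lambda>_. 0))) = six_strands x y z z y x" for x y z :: 'a
    by (rule ext) (auto simp: insert_pair_def six_strands_def)
  thus ?thesis by simp
qed

lemma colorings_nested_caps:
  "colorings (\<lambda>_. 1) (six_strands x y z u v w) nested_caps = (if (x, y, z) = (w, v, u) then 1 else 0)"
  by (simp add: six_strands_def delete_pair_def)

text \<open>The Burau matrix of \<open>aB\<close> at parameter -1, acting on the colours of the
  three braid strands.\<close>

definition turks_head_step :: "'a :: comm_ring_1 \<times> 'a \<times> 'a \<Rightarrow> 'a \<times> 'a \<times> 'a" where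
  "turks_head_step = (\<lambda>(x, y, z). (2 * x - y, z, 2 * z - x))"

lemma colorings_turks_head_step:
  "colorings f (six_strands x y z u v w) (concat (replicate q [(Over, 0), (Under, 1)]) @ D) =
    (case (turks_head_step ^^ q) (x, y, z) of (x', y', z') \<Rightarrow> colorings f (six_strands x' y' z' u v w) D)"
proof (induction q arbitrary: x y z)
  case (Suc q)
  have "pass_under 1 (pass_over 0 (six_strands x y z u v w)) = six_strands (2 * x - y) z (2 * z - x) u v w"
    by (rule ext) (simp add: pass_under_def pass_over_def six_strands_def)
  thus ?case using Suc by (simp add: turks_head_step_def funpow_swap1)
qed simp

text \<open>The minima give each returning strand the colour of its braid strand, and the maxima
  require the same colours after the braid.\<close>

lemma num_colorings_turks_head:
  fixes T :: "'a :: {finite, comm_ring_1} itself"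
  shows "num_colorings T (turks_head q) = card {v :: 'a \<times> 'a \<times> 'a. (turks_head_step ^^ q) v = v}"
proof -
  have "num_colorings T (turks_head q) =
      (\<Sum>x :: 'a \<in> UNIV. \<Sum>y\<in>UNIV. \<Sum>z\<in>UNIV. if (turks_head_step ^^ q) (x, y, z) = (x, y, z) then 1 else 0)"
    unfolding num_colorings_def turks_head_def colorings_nested_cups colorings_turks_head_step
    by (simp add: colorings_nested_caps case_prod_unfold prod_eq_iff del: colorings.simps One_nat_def)
  also have "\<dots> = (\<Sum>v \<in> UNIV. if (turks_head_step ^^ q) v = (v :: 'a \<times> 'a \<times> 'a) then 1 else 0)"
    by (simp only: sum.cartesian_product UNIV_Times_UNIV case_prod_unfold prod.collapse)
  also have "\<dots> = card {v :: 'a \<times> 'a \<times> 'a. (turks_head_step ^^ q) v = v}"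
    by (simp add: sum.If_cases)
  finally show ?thesis .
qed

text \<open>The modulus 5 is the determinant of the knot. Modulo 5 the second fixed point equation
  \<open>y = 2 * z - x\<close> implies the other two, which leaves two free colours.\<close>

lemma num_colorings_turks_head_2: "num_colorings TYPE(5) (turks_head 2) = 5 ^ 2"
proof -
  have "(turks_head_step ^^ 2) (x, y, z) = (4 * x - 2 * y - z, 2 * z - x, y - 4 * x + 4 * z)" for x y z :: 5
    by (simp add: turks_head_step_def numeral_2_eq_2 algebra_simps)
  moreover have "4 * x - 2 * (2 * z - x) - z = x + 5 * (x - z)"
      "2 * z - x - 4 * x + 4 * z = z + 5 * (z - x)" for x z :: 5
    by (simp_all only: ring_distribs) (simp_all add: algebra_simps)
  moreover have "5 * x = 0" for x :: 5
  proof -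
    have "(5 :: 5) = 0" by simp
    thus ?thesis by (simp only: mult_zero_left)
  qed
  ultimately have "{v :: 5 \<times> 5 \<times> 5. (turks_head_step ^^ 2) v = v} = (\<lambda>(x, z). (x, 2 * z - x, z)) ` UNIV"
    by (auto simp: image_iff)
  moreover have "inj (\<lambda>(x :: 5, z). (x, 2 * z - x, z))" by (auto simp: inj_on_def)
  ultimately show ?thesis
    by (simp add: num_colorings_turks_head card_image power2_eq_square)
qed

text \<open>The modulus 3 is chosen because the fourth power of the step is the identity modulo 3,
  so every triple of colours closes up.\<close>

lemma num_colorings_turks_head_4: "num_colorings TYPE(3) (turks_head 4) = 3 ^ 3"
proof -
  have step: "(turks_head_step ^^ 4) (x, y, z) = (x + 3 * (7 * x - 3 * y - 4 * z), y + 3 * (y - 4 * x + 3 * z),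
      z + 3 * (4 * y - 11 * x + 7 * z))" for x y z :: 3
    by (simp add: turks_head_step_def eval_nat_numeral)
  have zero: "3 * x = 0" for x :: 3
  proof -
    have "(3 :: 3) = 0" by simp
    thus ?thesis by (simp only: mult_zero_left)
  qed
  have "(turks_head_step ^^ 4) v = v" for v :: "3 \<times> 3 \<times> 3"
    by (cases v) (simp only: step zero add_0_right)
  thus ?thesis by (simp add: num_colorings_turks_head)
qed

lemma num_colorings_turks_head_5: "num_colorings TYPE(11) (turks_head 5) = 11 ^ 3"
proof -
  \<comment> \<open>Identity plus a multiple of 11: the fifth power of the step is trivial modulo
    11.\<close>
  have step: "(turks_head_step ^^ 5) (x, y, z) = (x + 11 * (5 * x - 2 * y - 3 * z), y + 11 * (y - 3 * x + 2 * z),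
      z + 11 * (3 * y - 8 * x + 5 * z))" for x y z :: 11
    by (simp add: turks_head_step_def eval_nat_numeral)
  have zero: "11 * x = 0" for x :: 11
  proof -
    have "(11 :: 11) = 0" by simp
    thus ?thesis by (simp only: mult_zero_left)
  qed
  have "(turks_head_step ^^ 5) v = v" for v :: "11 \<times> 11 \<times> 11"
    by (cases v) (simp only: step zero add_0_right)
  thus ?thesis by (simp add: num_colorings_turks_head)
qed


section \<open>Planar diagram codes\<close>

text \<open>Labels outside the table are shifted beyond all of its values, which makes the renaming injective.\<close>

definition relabel :: "(nat \<times> nat) list \<Rightarrow> nat \<Rightarrow> nat" where
  "relabel t x = (case map_of t x of Some y \<Rightarrow> y | None \<Rightarrow> x + Suc (sum_list (map snd t)))"

lemma inj_relabel:
  assumes "distinct (map snd t)"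
  shows "inj (relabel t)"
proof (rule injI)
  fix x y assume eq: "relabel t x = relabel t y"
  have le: "v \<le> sum_list (map snd t)" if "map_of t u = Some v" for u v
    using map_of_SomeD[OF that] by (intro member_le_sum_list) (force, simp)
  have same: "u = u'" if "map_of t u = Some v" "map_of t u' = Some v" for u u' v
    using that[THEN map_of_SomeD] assms inj_onD[of snd "set t" "(u, v)" "(u', v)"]
    by (simp add: distinct_map)
  show "x = y"
    using eq le[of x] le[of y] same[of x _ y]
    by (fastforce simp: relabel_def split: option.splits)
qed

text \<open>Comparison of codes becomes an evaluation: \<open>t\<close> is the renaming of edges,
  and the permutation \<open>p\<close> tells which crossing of \<open>P\<close> corresponds to each
  scanned one.\<close>

lemma has_pd_codeI:
  assumes scan: "snd (pd_scan 0 [] [] 0 D) = 0"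
    and t: "distinct (map snd t)"
    and p: "sort p = [0..<length P]"
    and X: "list_all2 (\<lambda>x y. map (relabel t) x = y \<or> map (relabel t) x = rotate 2 y)
      (fst (pd_scan 0 [] [] 0 D)) (map ((!) P) p)"
    and P: "list_all (\<lambda>y. length y = 4) P"
  shows "has_pd_code D P"
proof -
  let ?X = "fst (pd_scan 0 [] [] 0 D)"
  let ?c = "\<lambda>x :: nat list. {x, rotate 2 x}"
  have mset_p: "mset p = mset [0..<length P]" by (simp only: p[symmetric] mset_sort)
  have "map (\<lambda>x. ?c (map (relabel t) x)) ?X = map ?c (map ((!) P) p)"
  proof (rule nth_equalityI)
    show len: "length (map (\<lambda>x. ?c (map (relabel t) x)) ?X) = length (map ?c (map ((!) P) p))"
      using list_all2_lengthD[OF X] by simp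
    fix i assume "i < length (map (\<lambda>x. ?c (map (relabel t) x)) ?X)"
    hence i: "i < length ?X" "i < length p" using len by simp_all
    have "p ! i \<in> set [0..<length P]"
      using nth_mem[OF i(2)] mset_eq_setD[OF mset_p] by simp
    hence "length (P ! (p ! i)) = 4"
      using P by (simp add: list_all_length)
    \<comment> \<open>Two half turns of a list of four edges cancel, so either choice of the end of
      the lower strand gives the same unordered pair.\<close>
    hence rot: "rotate 2 (rotate 2 (P ! (p ! i))) = P ! (p ! i)"
      by (simp add: rotate_rotate rotate_id)
    have "map (relabel t) (?X ! i) = P ! (p ! i) \<or> map (relabel t) (?X ! i) = rotate 2 (P ! (p ! i))"
      using list_all2_nthD[OF X i(1)] i(2) by simp
    hence "?c (map (relabel t) (?X ! i)) = ?c (P ! (p ! i))"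
      by (elim disjE) (simp_all only: rot doubleton_eq_iff simp_thms)
    thus "map (\<lambda>x. ?c (map (relabel t) x)) ?X ! i = map ?c (map ((!) P) p) ! i"
      using i by (simp only: nth_map length_map)
  qed
  from arg_cong[OF this, of mset]
  have "image_mset (\<lambda>x. ?c (map (relabel t) x)) (mset ?X) = image_mset ?c (mset (map ((!) P) p))"
    by (simp only: mset_map)
  also have "mset (map ((!) P) p) = mset P"
    by (simp only: mset_map mset_p) (simp only: mset_map[symmetric] map_nth)
  finally have "same_pd_code ?X P"
    unfolding same_pd_code_def using inj_relabel[OF t] by (intro exI[of _ "relabel t"] conjI)
  thus ?thesis
    unfolding has_pd_code_def by (intro exI[of _ ?X] conjI) (simp_all add: prod_eq_iff scan)
qed

lemma link_diagram_turks_head: "link_diagram (turks_head q)"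
proof -
  have "tangle 6 (concat (replicate q [(Over, 0), (Under, 1)])) 6" by (induction q) auto
  moreover have "tangle 0 nested_cups 6" "tangle 6 nested_caps 0" by simp_all
  ultimately show ?thesis unfolding link_diagram_def turks_head_def by (blast intro: tangle_appendI)
qed

lemma is_link_with_pd_turks_head: "has_pd_code (turks_head q) P \<Longrightarrow> is_link_with_pd (turks_head q) P"
  unfolding is_link_with_pd_def isotopic_def using link_diagram_turks_head by blast

lemma has_pd_code_turks_head_2: "has_pd_code (turks_head 2) rolfsen_4_1"
proof (rule has_pd_codeI)
  \<comment> \<open>The names 0, 1 and 2 given at the minima are replaced when the maxima close the
    strands, so the table starts at 3, the first name given at a crossing.\<close>
  let ?t = "[(3, 5), (4, 2), (5, 8), (6, 3), (7, 1), (8, 6), (9, 4), (10, 7)] :: (nat \<times> nat) list"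
  let ?p = "[0, 3, 1, 2] :: nat list"
  show "snd (pd_scan 0 [] [] 0 (turks_head 2)) = 0" by code_simp
  show "distinct (map snd ?t)" by code_simp
  show "sort ?p = [0..<length rolfsen_4_1]" by code_simp
  show "list_all2 (\<lambda>x y. map (relabel ?t) x = y \<or> map (relabel ?t) x = rotate 2 y)
      (fst (pd_scan 0 [] [] 0 (turks_head 2))) (map ((!) rolfsen_4_1) ?p)" by code_simp
  show "list_all (\<lambda>y. length y = 4) rolfsen_4_1" by code_simp
qed

lemma has_pd_code_turks_head_4: "has_pd_code (turks_head 4) rolfsen_8_18"
proof (rule has_pd_codeI)
  let ?t = "[(3, 6), (4, 1), (5, 11), (6, 16), (7, 10), (8, 5), (9, 15), (10, 4), (11, 14), (12, 9),
    (13, 3), (14, 8), (15, 2), (16, 13), (17, 7), (18, 12)] :: (nat \<times> nat) list"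
  let ?p = "[0, 2, 5, 4, 7, 1, 3, 6] :: nat list"
  show "snd (pd_scan 0 [] [] 0 (turks_head 4)) = 0" by code_simp
  show "distinct (map snd ?t)" by code_simp
  show "sort ?p = [0..<length rolfsen_8_18]" by code_simp
  show "list_all2 (\<lambda>x y. map (relabel ?t) x = y \<or> map (relabel ?t) x = rotate 2 y)
      (fst (pd_scan 0 [] [] 0 (turks_head 4))) (map ((!) rolfsen_8_18) ?p)" by code_simp
  show "list_all (\<lambda>y. length y = 4) rolfsen_8_18" by code_simp
qed

lemma has_pd_code_turks_head_5: "has_pd_code (turks_head 5) rolfsen_10_123"
proof (rule has_pd_codeI)
  let ?t = "[(3, 9), (4, 2), (5, 16), (6, 3), (7, 17), (8, 10), (9, 4), (10, 11), (11, 5), (12, 18),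
    (13, 12), (14, 19), (15, 13), (16, 6), (17, 20), (18, 7), (19, 1), (20, 14), (21, 8), (22,
    15)] :: (nat \<times> nat) list"
  let ?p = "[0, 7, 4, 1, 8, 5, 2, 9, 6, 3] :: nat list"
  show "snd (pd_scan 0 [] [] 0 (turks_head 5)) = 0" by code_simp
  show "distinct (map snd ?t)" by code_simp
  show "sort ?p = [0..<length rolfsen_10_123]" by code_simp
  show "list_all2 (\<lambda>x y. map (relabel ?t) x = y \<or> map (relabel ?t) x = rotate 2 y)
      (fst (pd_scan 0 [] [] 0 (turks_head 5))) (map ((!) rolfsen_10_123) ?p)" by code_simp
  show "list_all (\<lambda>y. length y = 4) rolfsen_10_123" by code_simp
qed

section \<open>Exact values\<close>

text \<open>An explicit unknotting sequence bounds the number from above, and the count of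
  colourings excludes any shorter sequence.\<close>

lemma unknotting_number_eqI:
  fixes T :: "'a :: {finite, comm_ring_1} itself"
  assumes "crossing_changes n D (trivial_link 1)" "components D = 1"
    and "num_colorings T D = CARD('a) ^ (n + 1)" "CARD('a) > 1"
  shows "unknotting_number D = n"
  unfolding unknotting_number_def assms(2)
proof (rule Least_equality)
  fix j assume "crossing_changes j D (trivial_link 1)"
  from crossing_changes_lower_bound[OF this assms(3,4)] show "n \<le> j" by simp
qed (rule assms(1))

lemma unknotting_number_turks_head_2: "unknotting_number (turks_head 2) = 1"
proof (rule unknotting_number_eqI)
  show "crossing_changes 1 (turks_head 2) (trivial_link 1)" by (rule turks_head_2)
  show "components (turks_head 2) = 1" using components_turks_head[of 2 0] by (simp add: numeral_2_eq_2)
  show "num_colorings TYPE(5) (turks_head 2) = CARD(5) ^ (1 + 1)"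
    by (simp add: num_colorings_turks_head_2 del: One_nat_def)
qed simp

lemma unknotting_number_turks_head_4: "unknotting_number (turks_head 4) = 2"
proof (rule unknotting_number_eqI)
  show "crossing_changes 2 (turks_head 4) (trivial_link 1)"
    using crossing_changes_trans[OF turks_head_1 turks_head_reduce[of 1]] by simp
  show "components (turks_head 4) = 1" using components_turks_head[of 1 1] by simp
  show "num_colorings TYPE(3) (turks_head 4) = CARD(3) ^ (2 + 1)"
    by (simp add: num_colorings_turks_head_4)
qed simp

lemma unknotting_number_turks_head_5: "unknotting_number (turks_head 5) = 2"
proof (rule unknotting_number_eqI)
  show "crossing_changes 2 (turks_head 5) (trivial_link 1)" by (rule turks_head_5)
  show "components (turks_head 5) = 1" using components_turks_head[of 2 1] by simp
  show "num_colorings TYPE(11) (turks_head 5) = CARD(11) ^ (2 + 1)"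
    by (simp add: num_colorings_turks_head_5)
qed simp

theorem mainTheorem5:
  fixes K :: "nat \<Rightarrow> diagram"
  defines "K \<equiv> \<lambda>q. braid_closure 3 (braid_power [Sigma 1, SigmaInv 2] q)"
  shows "(\<forall>q m r :: nat. q \<ge> 1 \<and> q = 6 * m + r \<and> r \<le> 5 \<longrightarrow>
            unknotting_number (K q) \<le>
              (if r = 0 \<or> r = 1 then 4 * m
               else if r = 2 then 4 * m + 1
               else 4 * m + 2))
       \<and> is_link_with_pd (K 2) rolfsen_4_1 \<and> unknotting_number (K 2) = 1
       \<and> is_link_with_pd (K 4) rolfsen_8_18 \<and> unknotting_number (K 4) = 2
       \<and> is_link_with_pd (K 5) rolfsen_10_123 \<and> unknotting_number (K 5) = 2"
proof -
  have K: "K q = turks_head q" for q by (simp only: K_def braid_closure_turks_head)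
  show ?thesis
    unfolding K
    using unknotting_number_turks_head_bound unknotting_number_turks_head_2 unknotting_number_turks_head_4
      unknotting_number_turks_head_5 is_link_with_pd_turks_head[OF has_pd_code_turks_head_2]
      is_link_with_pd_turks_head[OF has_pd_code_turks_head_4] is_link_with_pd_turks_head[OF has_pd_code_turks_head_5]
    by blast
qed

end
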